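(* The solution of the closed-loop system $$\begin{pmatrix}\dot z\\ \dot p\end{pmatrix}=\begin{pmatrix}0 & \bar B\\ -\bar B^\top & -\bar B^\top D^{\mathrm c}\bar B\end{pmatrix}\begin{pmatrix}\frac{\partial H}{\partial z}\\ \frac{\partial H}{\partial p}\end{pmatrix}$$ converges (as $t\to\infty$) to the set of points $$\mathcal S:=\{(z;p)\in\mathbb R^{n(M+N)}\;|\; z\in\mathcal Z,\ p=0\},$$ where $\mathcal Z:=\{\bar z\in\mathbb R^{nM}\;|\;\frac{\partial H}{\partial z}\big|_{z=\bar z}\in\ker(\bar B^\top)\}$.
   Context: Notation: $(x_1;\ldots;x_N)$ denotes the stacked column vector $(x_1^\top,\ldots,x_N^\top)^\top$, $\|\cdot\|$ is the Euclidean norm, and $\otimes$ is the Kronecker product. Agents: there are $N$ agents, indexed by $\mathcal I=\{1,\ldots,N\}$. Agent $i$ is a unit point mass with position $q_i\in\mathbb R^n$, dynamics $\ddot q_i=u_i$ (with $u_i\in\mathbb R^n$ its control input), and momentum $p_i=\dot q_i$. Set $q=(q_1;\ldots;q_N)$, $p=(p_1;\ldots;p_N)\in\mathbb R^{nN}$. Graph: $\mathcal G=(V,E)$ is a graph with $V=\mathcal I$ and $|E|=M$ edges, one for each distance-based constraint between two agents; each edge is given an arbitrary orientation. $B=(b_{i,j})\in\mathbb R^{N\times M}$ is the incidence matrix, with $b_{i,j}=-1$ if $i$ is the tail of edge $j$, $b_{i,j}=+1$ if $i$ is its head, and $0$ otherwise. Put $\bar B:=B^\top\otimes I_n\in\mathbb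 R^{nM\times nN}$. The vector of relative positions is $z=\bar B q\in\mathbb R^{nM}$, so that $z_j=q_k-q_i$ if edge $j$ goes from $i$ to $k$. Virtual couplings: $r^{\mathrm c}>0$ is a critical distance. To each edge $j\in E$ are associated a symmetric positive definite damping matrix $D^{\mathrm c}_j\in\mathbb R^{n\times n}$, a rest length $0\le r_j\le r^{\mathrm c}$, and a spring function $k_j:\mathcal K_j\to\mathbb R_{>0}$, where $\mathcal K_j=\{z_j\in\mathbb R^n\;|\;\|z_j\|\le r\}$ for some $r>0$. Restricting the domain of $k_j$ to $\mathcal K_j$ limits the set of possible initial positions of the agents. Standing assumption: for all $j\in E$, $k_j$ is a $\mathcal C^1$, even function of $z_j$. Let $D^{\mathrm c}=\mathrm{diag}(D^{\mathrm c}_j)_{j\in E}$ (block diagonal). Hamiltonian: $$H(z,p)=\frac12\sum_{i\in\mathcal I}p_i^\top p_i+\frac12\sum_{j\in E}k_j(z_j)(\|z_j\|-r_j)^2 .$$ The closed-loop system results from $\dot z=\bar B\frac{\partial H}{\partial p}$, $\dot p=u$ with the control law $u=-\bar B^\top\big(D^{\mathrm c}\bar B\frac{\partial H}{\partial p}+\frac{\partial H}{\partial z}\big)$.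
   Formalization: Added: p(0) lies in the image of B̄ᵀ (zero total momentum on each connected component); |z_j(t)| stays above a positive constant on edges with r_j > 0, where H is not differentiable at z_j = 0. The solution is assumed to exist for all t ≥ 0 with z_j in K_j. Without these the claim fails. *)

theory Defs
  imports "HOL-Analysis.Analysis"
begin

(* Stacked vectors: an element (x_1; ...; x_N) of R^(nN) is a vector of type real ^ ('i \<times> 'n),
   with 'i indexing the blocks and 'n the coordinates inside a block. *)

definition block :: "real ^ ('a::finite \<times> 'n::finite) \<Rightarrow> 'a \<Rightarrow> real ^ 'n" where
  "block x a = (\<chi> l. x $ (a, l))"

definition kron :: "real ^ 'b ^ 'a \<Rightarrow> real ^ 'd ^ 'c \<Rightarrow>
    real ^ ('b::finite \<times> 'd::finite) ^ ('a::finite \<times> 'c::finite)" where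
  "kron A C = (\<chi> s t. A $ fst s $ fst t * C $ snd s $ snd t)"

definition block_diag :: "('a \<Rightarrow> real ^ 'n ^ 'n) \<Rightarrow>
    real ^ ('a::finite \<times> 'n::finite) ^ ('a \<times> 'n)" where
  "block_diag D = (\<chi> s t. if fst s = fst t then D (fst s) $ snd s $ snd t else 0)"

definition sym_pos_def :: "real ^ 'n::finite ^ 'n \<Rightarrow> bool" where
  "sym_pos_def A \<longleftrightarrow> transpose A = A \<and> (\<forall>x. x \<noteq> 0 \<longrightarrow> 0 < x \<bullet> (A *v x))"

(* The oriented graph is given by the tail and the head of each edge. *)

definition incidence :: "('e \<Rightarrow> 'i) \<Rightarrow> ('e \<Rightarrow> 'i) \<Rightarrow> real ^ 'e::finite ^ 'i::finite" where
  "incidence tail head =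
     (\<chi> i j. if i = tail j then - 1 else if i = head j then 1 else 0)"

definition Bbar :: "('e \<Rightarrow> 'i) \<Rightarrow> ('e \<Rightarrow> 'i) \<Rightarrow>
    real ^ ('i::finite \<times> 'n::finite) ^ ('e::finite \<times> 'n)" where
  "Bbar tail head = kron (transpose (incidence tail head)) (mat 1)"

(* Gradients are taken relative to the domain S, because the spring functions are only defined
   on closed balls. On convex sets with nonempty interior, such as those used below,
   the relative gradient is unique; in the interior it is the usual gradient. *)

definition has_gradient_within ::
    "('v::real_inner \<Rightarrow> real) \<Rightarrow> 'v \<Rightarrow> 'v \<Rightarrow> 'v set \<Rightarrow> bool" where
  "has_gradient_within f g x S \<longleftrightarrow> (f has_derivative (\<lambda>h. g \<bullet> h)) (at x within S)"

definition gradient_within :: "('v::real_inner \<Rightarrow> real) \<Rightarrow> 'v \<Rightarrow> 'v set \<Rightarrow> 'v" where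
  "gradient_within f x S = (SOME g. has_gradient_within f g x S)"

definition C1_on :: "'v::real_inner set \<Rightarrow> ('v \<Rightarrow> real) \<Rightarrow> bool" where
  "C1_on S f \<longleftrightarrow> (\<exists>g. continuous_on S g \<and> (\<forall>x\<in>S. has_gradient_within f (g x) x S))"

(* The product of the domains K_j of the spring functions. *)

definition zdom :: "real \<Rightarrow> (real ^ ('e::finite \<times> 'n::finite)) set" where
  "zdom r = {z. \<forall>j. block z j \<in> cball 0 r}"

definition hamiltonian :: "('e::finite \<Rightarrow> real ^ 'n::finite \<Rightarrow> real) \<Rightarrow> ('e \<Rightarrow> real) \<Rightarrow>
    real ^ ('e \<times> 'n) \<Rightarrow> real ^ ('i::finite \<times> 'n) \<Rightarrow> real" where
  "hamiltonian k rest z p =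
     1 / 2 * (\<Sum>i\<in>UNIV. block p i \<bullet> block p i)
   + 1 / 2 * (\<Sum>j\<in>UNIV. k j (block z j) * (norm (block z j) - rest j)\<^sup>2)"

(* dH/dz fails to exist at points where z_j = 0 for an edge j of positive rest length; dHdz is
   arbitrary there, so its uses below are guarded by H_z_diff. *)

definition H_z_diff :: "real \<Rightarrow> ('e::finite \<Rightarrow> real ^ 'n::finite \<Rightarrow> real) \<Rightarrow> ('e \<Rightarrow> real) \<Rightarrow>
    real ^ ('e \<times> 'n) \<Rightarrow> real ^ ('i::finite \<times> 'n) \<Rightarrow> bool" where
  "H_z_diff r k rest z p \<longleftrightarrow>
     z \<in> zdom r \<and> (\<exists>g. has_gradient_within (\<lambda>\<zeta>. hamiltonian k rest \<zeta> p) g z (zdom r))"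

definition dHdz :: "real \<Rightarrow> ('e::finite \<Rightarrow> real ^ 'n::finite \<Rightarrow> real) \<Rightarrow> ('e \<Rightarrow> real) \<Rightarrow>
    real ^ ('e \<times> 'n) \<Rightarrow> real ^ ('i::finite \<times> 'n) \<Rightarrow> real ^ ('e \<times> 'n)" where
  "dHdz r k rest z p = gradient_within (\<lambda>\<zeta>. hamiltonian k rest \<zeta> p) z (zdom r)"

definition dHdp :: "('e::finite \<Rightarrow> real ^ 'n::finite \<Rightarrow> real) \<Rightarrow> ('e \<Rightarrow> real) \<Rightarrow>
    real ^ ('e \<times> 'n) \<Rightarrow> real ^ ('i::finite \<times> 'n) \<Rightarrow> real ^ ('i \<times> 'n)" where
  "dHdp k rest z p = gradient_within (\<lambda>\<eta>. hamiltonian k rest z \<eta>) p UNIV"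

definition closed_loop_solution ::
    "('e::finite \<Rightarrow> 'i::finite) \<Rightarrow> ('e \<Rightarrow> 'i) \<Rightarrow> ('e \<Rightarrow> real ^ 'n::finite ^ 'n) \<Rightarrow> real \<Rightarrow>
     ('e \<Rightarrow> real ^ 'n \<Rightarrow> real) \<Rightarrow> ('e \<Rightarrow> real) \<Rightarrow>
     (real \<Rightarrow> real ^ ('e \<times> 'n)) \<Rightarrow> (real \<Rightarrow> real ^ ('i \<times> 'n)) \<Rightarrow> bool" where
  "closed_loop_solution tail head D r k rest z p \<longleftrightarrow>
     (let B = Bbar tail head in
      \<forall>t\<ge>0. H_z_diff r k rest (z t) (p t)
        \<and> (z has_vector_derivative B *v dHdp k rest (z t) (p t)) (at t within {0..})
        \<and> (p has_vector_derivative
              - (transpose B *v dHdz r k rest (z t) (p t))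
              - (transpose B ** block_diag D ** B) *v dHdp k rest (z t) (p t))
            (at t within {0..}))"

(* H is the sum of a function of z and one of p, so dH/dz does not depend on the momentum, which
   is set to 0. *)

definition Zset :: "('e::finite \<Rightarrow> 'i::finite) \<Rightarrow> ('e \<Rightarrow> 'i) \<Rightarrow> real \<Rightarrow>
    ('e \<Rightarrow> real ^ 'n::finite \<Rightarrow> real) \<Rightarrow> ('e \<Rightarrow> real) \<Rightarrow> (real ^ ('e \<times> 'n)) set" where
  "Zset tail head r k rest =
     {z. H_z_diff r k rest z (0 :: real ^ ('i \<times> 'n))
       \<and> transpose (Bbar tail head) *v dHdz r k rest z (0 :: real ^ ('i \<times> 'n)) = 0}"

definition Sset :: "('e::finite \<Rightarrow> 'i::finite) \<Rightarrow> ('e \<Rightarrow> 'i) \<Rightarrow> real \<Rightarrow>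
    ('e \<Rightarrow> real ^ 'n::finite \<Rightarrow> real) \<Rightarrow> ('e \<Rightarrow> real) \<Rightarrow>
    ((real ^ ('e \<times> 'n)) \<times> (real ^ ('i \<times> 'n))) set" where
  "Sset tail head r k rest = {(z, p). z \<in> Zset tail head r k rest \<and> p = 0}"

(* Not phrased with infdist, since infdist to the empty set is 0. *)

definition converges_to_set :: "(real \<Rightarrow> 'v::metric_space) \<Rightarrow> 'v set \<Rightarrow> bool" where
  "converges_to_set x S \<longleftrightarrow>
     (\<forall>\<epsilon>>0. eventually (\<lambda>t. \<exists>s\<in>S. dist (x t) s < \<epsilon>) at_top)"

end

theory Submission
  imports Defs
begin

text \<open>
  Along a solution, \<open>H\<close> decreases at the rate \<open>W = (B p) \<bullet> D (B p)\<close>. The assumptions confine \<open>z\<close> to a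
  compact set on which \<open>\<partial>H/\<partial>z\<close> is continuous, so \<open>(z, p)\<close> is bounded and Lipschitz. Since \<open>H\<close> converges
  and \<open>W\<close> is uniformly continuous in time, Barbalat's lemma gives \<open>W \<longrightarrow> 0\<close>, that is \<open>B p \<longrightarrow> 0\<close>. The momentum
  never leaves the range of \<open>B\<^sup>T\<close>, on which \<open>B\<close> is injective, so \<open>p \<longrightarrow> 0\<close>. A second application of
  Barbalat's lemma, now to \<open>p\<close>, gives \<open>p' \<longrightarrow> 0\<close> and hence \<open>B\<^sup>T \<partial>H/\<partial>z \<longrightarrow> 0\<close>. On a compact set this means
  convergence to the zero set of \<open>B\<^sup>T \<partial>H/\<partial>z\<close>.
\<close>

section \<open>Asymptotics of functions on the half-line\<close>

text \<open>For a fixed step \<open>c\<close> the difference \<open>f (t + c) - f t\<close> tends to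
  0 because \<open>f\<close> converges. Uniform continuity of \<open>f'\<close> keeps this
  difference within \<open>e / 2 * c\<close> of \<open>c *\<^sub>R f' t\<close> for every
  \<open>t\<close>, so \<open>f' t\<close> itself must become small.\<close>

lemma barbalat:
  fixes f :: "real \<Rightarrow> 'a::real_normed_vector"
  assumes deriv: "\<And>t. 0 \<le> t \<Longrightarrow> (f has_vector_derivative f' t) (at t within {0..})"
    and lim: "(f \<longlongrightarrow> l) at_top"
    and uc: "uniformly_continuous_on {0..} f'"
  shows "(f' \<longlongrightarrow> 0) at_top"
proof (rule tendstoI)
  fix e :: real assume e: "0 < e"
  obtain d where d: "d > 0"
    and dd: "\<And>s t. 0 \<le> s \<Longrightarrow> 0 \<le> t \<Longrightarrow> dist t s < d \<Longrightarrow> dist (f' t) (f' s) < e / 2"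
    using uc[unfolded uniformly_continuous_on_def, rule_format, of "e/2"] e by force
  define c where "c = d / 2"
  have c: "c > 0" "c < d" using d by (auto simp: c_def)
  have bound: "norm (f (t + c) - f t - c *\<^sub>R f' t) \<le> e / 2 * c" if t: "0 \<le> t" for t
  proof -
    \<comment> \<open>Subtracting the linear part of slope \<open>f' t\<close> turns the error into
      an increment of \<open>g\<close>. Its derivative \<open>f' s - f' t\<close> is at most
      \<open>e / 2\<close> in norm on the whole step, since \<open>c < d\<close>.\<close>
    define g where "g s = f s - s *\<^sub>R f' t" for s
    have "norm (g (t + c) - g t) \<le> e / 2 * norm (t + c - t)"
    proof (rule differentiable_bound[of "{t..t + c}" g "\<lambda>s h. h *\<^sub>R (f' s - f' t)"])
      fix s assume s: "s \<in> {t..t + c}"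
      have "(f has_vector_derivative f' s) (at s within {t..t + c})"
        by (rule has_vector_derivative_within_subset[OF deriv]) (use s t in auto)
      then have "(g has_vector_derivative f' s - 1 *\<^sub>R f' t) (at s within {t..t + c})"
        unfolding g_def by (auto intro!: derivative_eq_intros)
      then show "(g has_derivative (\<lambda>h. h *\<^sub>R (f' s - f' t))) (at s within {t..t + c})"
        by (simp add: has_vector_derivative_def)
      have n: "norm (f' s - f' t) \<le> e / 2"
        using dd[of t s] s t c by (auto simp: dist_norm)
      then show "onorm (\<lambda>h. h *\<^sub>R (f' s - f' t)) \<le> e / 2"
        by (intro onorm_bound) (use e mult_left_mono[OF n abs_ge_zero] in \<open>auto simp: mult.commute\<close>)
    qed (use c in auto)
    then show ?thesis using c by (simp add: g_def algebra_simps)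
  qed
  have "((\<lambda>t. f (t + c)) \<longlongrightarrow> l) at_top"
    by (rule filterlim_compose[OF lim])
      (rule filterlim_tendsto_add_at_top[OF tendsto_const filterlim_ident, of c, unfolded add.commute[of c]])
  then have "((\<lambda>t. f (t + c) - f t) \<longlongrightarrow> l - l) at_top"
    by (intro tendsto_diff lim)
  then have "eventually (\<lambda>t. norm (f (t + c) - f t) < e / 2 * c) at_top"
    using e c by (auto dest!: tendstoD[where e="e/2*c"] simp: dist_norm)
  then show "eventually (\<lambda>t. dist (f' t) 0 < e) at_top"
    using eventually_ge_at_top[of 0]
  proof eventually_elim
    case (elim t)
    have "norm (c *\<^sub>R f' t) \<le> norm (f (t + c) - f t) + norm (f (t + c) - f t - c *\<^sub>R f' t)"
      by (metis norm_triangle_sub norm_minus_commute add.commute)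
    also have "\<dots> < e * c" using bound[of t] elim by (simp add: field_simps)
    finally show ?case using c by (simp add: mult.commute)
  qed
qed

text \<open>Removing the open \<open>e\<close>-neighbourhood of the zero set from \<open>C\<close>
  leaves a compact set, on which \<open>norm (W x)\<close> has a positive minimum. As
  \<open>W (w t)\<close> tends to 0, \<open>w t\<close> eventually avoids that set.\<close>

lemma converges_to_zero_set_on_compact:
  fixes W :: "'v::metric_space \<Rightarrow> 'b::real_normed_vector"
  assumes C: "compact C" and W: "continuous_on C W"
    and w: "eventually (\<lambda>t. w t \<in> C) at_top"
    and lim: "((\<lambda>t. W (w t)) \<longlongrightarrow> 0) at_top"
  shows "converges_to_set w {x \<in> C. W x = 0}"
  unfolding converges_to_set_def
proof (intro allI impI)
  fix e :: real assume e: "0 < e"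
  let ?S = "{x \<in> C. W x = 0}"
  define A where "A = C - (\<Union>s\<in>?S. ball s e)"
  have A: "compact A" unfolding A_def by (intro compact_diff C open_UN) auto
  have ev: "eventually (\<lambda>t. w t \<notin> A) at_top"
  proof (cases "A = {}")
    case False
    have "continuous_on A (\<lambda>x. norm (W x))"
      by (intro continuous_on_norm continuous_on_subset[OF W]) (auto simp: A_def)
    then obtain x where x: "x \<in> A" and m: "\<And>y. y \<in> A \<Longrightarrow> norm (W x) \<le> norm (W y)"
      using continuous_attains_inf[OF A False] by blast
    have "W x \<noteq> 0" using x e by (auto simp: A_def)
    with tendstoD[OF lim, of "norm (W x)"] show ?thesis
      by (auto elim!: eventually_mono dest: m)
  qed auto
  show "eventually (\<lambda>t. \<exists>s\<in>?S. dist (w t) s < e) at_top"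
    using ev w by eventually_elim (auto simp: A_def dist_commute)
qed

lemma uniformly_continuous_on_bounded_derivative:
  fixes w :: "real \<Rightarrow> 'v::real_normed_vector"
  assumes deriv: "\<And>t. 0 \<le> t \<Longrightarrow> (w has_vector_derivative w' t) (at t within {0..})"
    and bd: "\<And>t. 0 \<le> t \<Longrightarrow> norm (w' t) \<le> L"
  shows "uniformly_continuous_on {0..} w"
proof -
  have L: "L \<ge> 0" using bd[of 0] norm_ge_zero[of "w' 0"] by linarith
  have "L-lipschitz_on {0..} w"
  proof (rule bounded_derivative_imp_lipschitz[of _ _ "\<lambda>t h. h *\<^sub>R w' t"])
    fix t :: real assume t: "t \<in> {0..}"
    then show "(w has_derivative (\<lambda>h. h *\<^sub>R w' t)) (at t within {0..})"
      using deriv[of t] by (simp add: has_vector_derivative_def)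
    show "onorm (\<lambda>h. h *\<^sub>R w' t) \<le> L"
      by (rule onorm_bound) (use L bd[of t] t in \<open>auto simp: mult.commute[of L] intro!: mult_left_mono\<close>)
  qed (use L in auto)
  then show ?thesis by (rule lipschitz_on_uniformly_continuous)
qed

lemma uniformly_continuous_on_comp_compact:
  fixes w :: "'a::metric_space \<Rightarrow> 'b::metric_space" and F :: "'b \<Rightarrow> 'c::metric_space"
  assumes C: "compact C" and F: "continuous_on C F"
    and w: "uniformly_continuous_on S w" "w ` S \<subseteq> C"
  shows "uniformly_continuous_on S (\<lambda>t. F (w t))"
proof (rule uniformly_continuous_on_compose[OF w(1)])
  show "uniformly_continuous_on (w ` S) F"
    using compact_uniformly_continuous[OF F C] w(2)
    unfolding uniformly_continuous_on_def by (meson subsetD)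
qed

lemma antimono_if_nonpos_derivative:
  fixes h :: "real \<Rightarrow> real"
  assumes deriv: "\<And>t. 0 \<le> t \<Longrightarrow> (h has_vector_derivative h' t) (at t within {0..})"
    and neg: "\<And>t. 0 \<le> t \<Longrightarrow> h' t \<le> 0"
    and st: "0 \<le> s" "s \<le> t"
  shows "h t \<le> h s"
proof (rule DERIV_nonpos_imp_decreasing_open[OF st(2)])
  fix x assume x: "s < x" "x < t"
  have "(h has_vector_derivative h' x) (at x)"
    using deriv[of x] x st at_within_interior[of x "{0..}"] by (simp add: interior_real_atLeast)
  then show "\<exists>y. (h has_real_derivative y) (at x) \<and> y \<le> 0"
    using neg[of x] x st by (auto simp: has_real_derivative_iff_has_vector_derivative)
next
  have "continuous_on {0..} h"
    using deriv by (auto intro!: continuous_on_vector_derivative)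
  then show "continuous_on {s..t} h" by (rule continuous_on_subset) (use st in auto)
qed

lemma tendsto_bounded_below_nonpos_derivative:
  fixes h :: "real \<Rightarrow> real"
  assumes deriv: "\<And>t. 0 \<le> t \<Longrightarrow> (h has_vector_derivative h' t) (at t within {0..})"
    and neg: "\<And>t. 0 \<le> t \<Longrightarrow> h' t \<le> 0"
    and low: "\<And>t. 0 \<le> t \<Longrightarrow> m \<le> h t"
  obtains l where "(h \<longlongrightarrow> l) at_top"
proof -
  note anti = antimono_if_nonpos_derivative[OF deriv neg]
  define l where "l = Inf (h ` {0..})"
  have bdd: "bdd_below (h ` {0..})" by (rule bdd_belowI2[of _ m]) (use low in auto)
  have "(h \<longlongrightarrow> l) at_top"
  proof (rule decreasing_tendsto)
    show "eventually (\<lambda>t. l \<le> h t) at_top"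
      using eventually_ge_at_top[of 0]
      by eventually_elim (auto simp: l_def intro!: cInf_lower bdd)
    fix x assume "l < x"
    then obtain s where s: "0 \<le> s" "h s < x"
      using cInf_less_iff[OF _ bdd, of x] by (auto simp: l_def)
    show "eventually (\<lambda>t. h t < x) at_top"
      using eventually_ge_at_top[of s] by eventually_elim (use anti s in force)
  qed
  then show ?thesis by (rule that)
qed

text \<open>Let \<open>u\<close> be the component of \<open>p t\<close> orthogonal to
  \<open>S\<close>, with \<open>t\<close> fixed. Then \<open>u \<bullet> p s\<close> has zero
  derivative in \<open>s\<close> and vanishes at \<open>s = 0\<close>, so
  \<open>u \<bullet> u = u \<bullet> p t = 0\<close>.\<close>

lemma in_subspace_if_derivative_in_subspace:
  fixes p :: "real \<Rightarrow> 'v::euclidean_space"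
  assumes S: "subspace S" and p0: "p 0 \<in> S" 
    and deriv: "\<And>t. 0 \<le> t \<Longrightarrow> (p has_vector_derivative p' t) (at t within {0..})"
    and p': "\<And>t. 0 \<le> t \<Longrightarrow> p' t \<in> S" and t: "0 \<le> t"
  shows "p t \<in> S"
proof -
  obtain y u where y: "y \<in> span S" and u: "\<And>v. v \<in> span S \<Longrightarrow> orthogonal u v" and eq: "p t = y + u"
    using orthogonal_subspace_decomp_exists[of S "p t"] by metis
  have sp: "span S = S" using S by (simp add: span_eq_iff)
  have "((\<lambda>s. u \<bullet> p s) has_derivative (\<lambda>_. 0)) (at s within {0..})" if "s \<in> {0..}" for s
  proof -
    have "((\<lambda>s. u \<bullet> p s) has_derivative (\<lambda>h. u \<bullet> (h *\<^sub>R p' s))) (at s within {0..})"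
      by (rule has_derivative_inner_right)
        (use deriv[of s] that in \<open>simp add: has_vector_derivative_def\<close>)
    moreover have "u \<bullet> p' s = 0" using u[of "p' s"] p'[of s] sp that by (simp add: orthogonal_def)
    ultimately show ?thesis by simp
  qed
  then obtain c where c: "\<And>s. s \<in> {0..} \<Longrightarrow> u \<bullet> p s = c"
    using has_derivative_zero_constant[of "{0..}" "\<lambda>s. u \<bullet> p s"] by auto
  have "u \<bullet> p t = u \<bullet> p 0" using c[of t] c[of 0] t by simp
  also have "\<dots> = 0" using u[of "p 0"] p0 sp by (simp add: orthogonal_def)
  finally have "u \<bullet> u = 0" using u[OF y] by (simp add: eq inner_add_right orthogonal_def)
  then show ?thesis using y eq sp by simp
qed

section \<open>Uniqueness of relative gradients\<close>

text \<open>At boundary points of \<open>S\<close> the segments to an interior ball still determine the gradient, whereas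
  the coordinate directions may leave \<open>S\<close>.\<close>

lemma gradient_within_unique:
  assumes S: "convex S" "interior S \<noteq> {}" and x: "x \<in> S"
    and g: "has_gradient_within f g x S" and g': "has_gradient_within f g' x S"
  shows "g = g'"
proof -
  define u where "u = g - g'"
  have 0: "((\<lambda>_. 0) has_derivative (\<lambda>h. u \<bullet> h)) (at x within S)"
    using has_derivative_diff[OF g[unfolded has_gradient_within_def] g'[unfolded has_gradient_within_def]]
    by (simp add: u_def inner_diff_left)
  \<comment> \<open>Along the segment from \<open>x\<close> to \<open>y\<close>, which convexity
    keeps in \<open>S\<close>, the zero function has one-sided derivative
    \<open>u \<bullet> (y - x)\<close> at its start.\<close>
  have dir: "u \<bullet> (y - x) = 0" if y: "y \<in> S" for y
  proof -
    have m: "(\<lambda>t. x + t *\<^sub>R (y - x)) ` {0..1} \<subseteq> S"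
      using convexD_alt[OF S(1) x y] by (auto simp: algebra_simps)
    have "((\<lambda>t. x + t *\<^sub>R (y - x)) has_derivative (\<lambda>t. t *\<^sub>R (y - x))) (at 0 within {0..1::real})"
      by (auto intro!: derivative_eq_intros)
    from has_derivative_in_compose[OF this has_derivative_subset[OF _ m], of "\<lambda>_. 0" "\<lambda>h. u \<bullet> h"] 0
    have "((\<lambda>_. 0) has_derivative (\<lambda>t. u \<bullet> (t *\<^sub>R (y - x)))) (at 0 within {0..1::real})"
      by simp
    then have "((\<lambda>_. 0::real) has_vector_derivative (u \<bullet> (y - x))) (at 0 within cbox 0 (1::real))"
      by (simp add: has_vector_derivative_def)
    from vector_derivative_unique_within_closed_interval[OF _ _ this has_vector_derivative_const]
    show ?thesis by simp
  qed
  obtain y e where e: "e > 0" "cball y e \<subseteq> S"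
    using S(2) by (auto simp: mem_interior_cball)
  \<comment> \<open>Scaled so that \<open>y + s *\<^sub>R u\<close> stays in the ball around
    \<open>y\<close>; the summand 1 covers \<open>u = 0\<close>. Comparing the directions to
    \<open>y + s *\<^sub>R u\<close> and to \<open>y\<close> isolates
    \<open>u \<bullet> u\<close>.\<close>
  define s where "s = e / (norm u + 1)"
  have s: "s > 0" "s * norm u \<le> e"
    using e by (auto simp: s_def field_simps add_pos_nonneg add_nonneg_pos)
  have "y + s *\<^sub>R u \<in> S" "y \<in> S" using e s by (auto simp: dist_norm intro!: subsetD[OF e(2)])
  from dir[OF this(1)] dir[OF this(2)] have "s * (u \<bullet> u) = 0"
    by (simp add: inner_diff_right inner_add_right)
  then show ?thesis using s by (simp add: u_def)
qed

lemma gradient_within_eqI: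
  assumes "convex S" "interior S \<noteq> {}" "x \<in> S" "has_gradient_within f g x S"
  shows "gradient_within f x S = g"
  unfolding gradient_within_def
  by (rule some_equality) (use assms gradient_within_unique in blast)+


section \<open>Convergence for an abstract damped Hamiltonian system\<close>

lemma inner_transpose_mult:
  fixes B :: "real ^ 'c ^ 'd"
  shows "x \<bullet> (transpose B *v y) = (B *v x) \<bullet> y"
  by (metis dot_lmul_matrix inner_commute transpose_matrix_vector)

text \<open>The dynamical core, separated from graphs and springs: \<open>V\<close> is the potential
  energy, \<open>G\<close> its gradient, \<open>R\<close> the damping, and \<open>K\<close> a
  compact set containing the path of \<open>z\<close> on which \<open>G\<close> is
  continuous.\<close>

lemma damped_interconnection_converges:
  fixes B :: "real ^ 'c ^ 'd" and R :: "real ^ 'd ^ 'd"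
    and z :: "real \<Rightarrow> real ^ 'd" and p :: "real \<Rightarrow> real ^ 'c"
  assumes K: "compact K" "K \<subseteq> S"
    and V: "\<And>x. x \<in> K \<Longrightarrow> has_gradient_within V (G x) x S"
    and G: "continuous_on K G"
    and R: "\<And>x. x \<noteq> 0 \<Longrightarrow> 0 < x \<bullet> (R *v x)"
    and zK: "\<And>t. 0 \<le> t \<Longrightarrow> z t \<in> K"
    and z': "\<And>t. 0 \<le> t \<Longrightarrow> (z has_vector_derivative B *v p t) (at t within {0..})"
    and p': "\<And>t. 0 \<le> t \<Longrightarrow> (p has_vector_derivative
      - (transpose B *v G (z t)) - (transpose B ** R ** B) *v p t) (at t within {0..})"
    and p0: "p 0 \<in> range ((*v) (transpose B))"
  shows "converges_to_set (\<lambda>t. (z t, p t)) {(x, y). x \<in> K \<and> transpose B *v G x = 0 \<and> y = 0}"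
proof -
  define U where "U = range ((*v) (transpose B))"
  have U: "subspace U"
    unfolding U_def by (intro linear_subspace_image subspace_UNIV) (auto intro: matrix_vector_mul_linear)
  define P where "P x y = - (transpose B *v G x) - (transpose B ** R ** B) *v y" for x y
  \<comment> \<open>Factoring out \<open>transpose B\<close> shows that the force always lies in
    \<open>U\<close>.\<close>
  have P_alt: "P x y = transpose B *v (- G x - R *v (B *v y))" for x y
    by (simp add: P_def matrix_vector_mult_diff_distrib matrix_vector_mul_assoc matrix_mul_assoc
        linear_neg[OF matrix_vector_mul_linear])
  have pU: "p t \<in> U" if "0 \<le> t" for t
    by (rule in_subspace_if_derivative_in_subspace[OF U p0[folded U_def] p' _ that])
      (simp_all only: P_def[symmetric] P_alt U_def rangeI)
  define h where "h = (\<lambda>t. 1 / 2 * (p t \<bullet> p t) + V (z t))"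
  define W where "W = (\<lambda>(x :: real ^ 'd, y). (B *v y) \<bullet> (R *v (B *v y)))"
  have W_nonneg: "0 \<le> W w" for w
    using R[of "B *v snd w"] by (cases "B *v snd w = 0") (simp_all add: W_def case_prod_beta)
  have h': "(h has_vector_derivative - W (z t, p t)) (at t within {0..})" if t: "0 \<le> t" for t
  proof -
    \<comment> \<open>\<open>V\<close> is differentiable only relative to \<open>S\<close>, so the
      chain rule is applied within the image of \<open>z\<close>, which lies in
      \<open>K\<close>.\<close>
    have "(V has_derivative (\<lambda>v. G (z t) \<bullet> v)) (at (z t) within z ` {0..})"
      by (rule has_derivative_subset[OF V[OF zK[OF t], unfolded has_gradient_within_def]])
        (use zK K in auto)
    from has_derivative_in_compose[OF z'[OF t, unfolded has_vector_derivative_def] this]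
    have dV: "((\<lambda>s. V (z s)) has_vector_derivative G (z t) \<bullet> (B *v p t)) (at t within {0..})"
      by (simp add: has_vector_derivative_def)
    have dp: "((\<lambda>s. 1 / 2 * (p s \<bullet> p s)) has_vector_derivative p t \<bullet> P (z t) (p t)) (at t within {0..})"
    proof -
      have "((\<lambda>s. 1 / 2 * (p s \<bullet> p s)) has_derivative
          (\<lambda>s. 1 / 2 * (p t \<bullet> (s *\<^sub>R P (z t) (p t)) + (s *\<^sub>R P (z t) (p t)) \<bullet> p t))) (at t within {0..})"
        using p'[OF t] unfolding has_vector_derivative_def P_def
        by (intro has_derivative_mult_right has_derivative_inner)
      then show ?thesis
        by (simp add: has_vector_derivative_def inner_commute)
    qed
    \<comment> \<open>Power balance: the two interconnection terms are adjoint and cancel, so only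
      the dissipation remains.\<close>
    have "p t \<bullet> P (z t) (p t) + G (z t) \<bullet> (B *v p t) = - W (z t, p t)"
      by (simp add: P_alt W_def inner_transpose_mult inner_diff_right inner_commute
          del: transpose_matrix_vector)
    then show ?thesis
      using has_vector_derivative_add[OF dp dV] by (simp only: h_def)
  qed
  have contV: "continuous_on K V"
    using V K(2) unfolding continuous_on_eq_continuous_within has_gradient_within_def
    by (meson continuous_within_subset has_derivative_continuous)
  obtain m where m: "\<And>x. x \<in> K \<Longrightarrow> m \<le> V x"
  proof -
    have "K \<noteq> {}" using zK[of 0] by auto
    then show ?thesis using continuous_attains_inf[OF K(1) _ contV] that by blast
  qed
  have h_low: "m \<le> h t" if "0 \<le> t" for t
    using m[OF zK[OF that]] by (simp add: h_def add_increasing)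
  have h_anti: "h t \<le> h 0" if "0 \<le> t" for t
    using antimono_if_nonpos_derivative[OF h' _ _ that] W_nonneg by auto
  \<comment> \<open>The radius comes from \<open>h t \<le> h 0\<close> together with
    \<open>m \<le> V\<close>. Intersecting with \<open>U\<close> records that the momentum never
    leaves the range of \<open>transpose B\<close>.\<close>
  define C where "C = K \<times> (cball 0 (sqrt (2 * (h 0 - m))) \<inter> U)"
  have C: "compact C"
    unfolding C_def by (intro compact_Times K compact_Int_closed compact_cball closed_subspace U)
  have wC: "(z t, p t) \<in> C" if "0 \<le> t" for t
  proof -
    have "(norm (p t))\<^sup>2 \<le> 2 * (h 0 - m)"
      using h_anti[OF that] m[OF zK[OF that]] by (simp add: h_def power2_norm_eq_inner)
    then show ?thesis
      using zK[OF that] pU[OF that] by (auto simp: C_def real_le_rsqrt)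
  qed
  have contP: "continuous_on C (\<lambda>(x, y). P x y)"
    unfolding P_def C_def case_prod_beta
    by (intro continuous_intros continuous_on_compose2[OF G] matrix_vector_mult_linear_continuous_on
      linear_continuous_on_compose[OF _ matrix_vector_mul_linear]) auto
  have contW: "continuous_on C W"
    unfolding W_def case_prod_beta
    by (intro continuous_intros linear_continuous_on_compose[OF _ matrix_vector_mul_linear])
  have contF: "continuous_on C (\<lambda>(x, y). (B *v y, P x y))"
    using contP unfolding case_prod_beta
    by (intro continuous_intros linear_continuous_on_compose[OF _ matrix_vector_mul_linear])
  have w': "((\<lambda>t. (z t, p t)) has_vector_derivative (B *v p t, P (z t) (p t))) (at t within {0..})"
    if "0 \<le> t" for t
    using has_vector_derivative_Pair[OF z'[OF that] p'[OF that]] by (simp add: P_def)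
  have uc: "uniformly_continuous_on {0..} (\<lambda>t. (z t, p t))"
  proof -
    obtain L where "\<And>w. w \<in> C \<Longrightarrow> norm ((\<lambda>(x, y). (B *v y, P x y)) w) \<le> L"
      using compact_imp_bounded[OF compact_continuous_image[OF contF C]]
      unfolding bounded_iff by blast
    then show ?thesis
      using uniformly_continuous_on_bounded_derivative[OF w', of L] wC by fastforce
  qed
  have wC': "(\<lambda>t. (z t, p t)) ` {0..} \<subseteq> C" using wC by auto
  obtain l where l: "(h \<longlongrightarrow> l) at_top"
    using tendsto_bounded_below_nonpos_derivative[OF h' _ h_low] W_nonneg by auto
  have "((\<lambda>t. - W (z t, p t)) \<longlongrightarrow> 0) at_top"
    by (rule barbalat[OF h' l])
      (use uniformly_continuous_on_minus[OF uniformly_continuous_on_comp_compact[OF C contW uc wC']] in auto)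
  then have "((\<lambda>t. W (z t, p t)) \<longlongrightarrow> 0) at_top"
    using tendsto_minus by fastforce
  moreover have ev: "eventually (\<lambda>t. (z t, p t) \<in> C) at_top"
    using eventually_ge_at_top[of 0] by eventually_elim (rule wC)
  ultimately have "converges_to_set (\<lambda>t. (z t, p t)) {w \<in> C. W w = 0}"
    by (intro converges_to_zero_set_on_compact C contW)
  \<comment> \<open>\<open>B\<close> is injective on \<open>U\<close>: if \<open>B *v y = 0\<close>
    and \<open>y = transpose B *v v\<close>, then
    \<open>y \<bullet> y = (B *v y) \<bullet> v = 0\<close>.\<close>
  moreover have "y = 0" if yC: "(x, y) \<in> C" and Wy: "W (x, y) = 0" for x y
  proof -
    have By: "B *v y = 0" using R[of "B *v y"] Wy by (force simp: W_def)
    obtain v where "y = transpose B *v v" using yC by (auto simp: C_def U_def)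
    with By have "y \<bullet> y = 0" using inner_transpose_mult[of y B v] by simp
    then show ?thesis by simp
  qed
  ultimately have near: "eventually (\<lambda>t. \<exists>x. dist (z t, p t) (x, 0) < e) at_top" if "0 < e" for e
    using that unfolding converges_to_set_def by (fast elim: eventually_mono)
  have "(p \<longlongrightarrow> 0) at_top"
  proof (rule tendstoI)
    fix e :: real assume "0 < e"
    from near[OF this] show "eventually (\<lambda>t. dist (p t) 0 < e) at_top"
      by eventually_elim (metis dist_snd_le le_less_trans snd_conv)
  qed
  moreover from this p' have "((\<lambda>t. P (z t) (p t)) \<longlongrightarrow> 0) at_top"
    unfolding P_def[symmetric]
    by (intro barbalat[of p])
      (use uniformly_continuous_on_comp_compact[OF C contP uc wC'] in auto)
  ultimately have "((\<lambda>t. (P (z t) (p t), p t)) \<longlongrightarrow> (0, 0)) at_top"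
    by (intro tendsto_Pair)
  then have "((\<lambda>t. (\<lambda>(x, y). (P x y, y)) (z t, p t)) \<longlongrightarrow> 0) at_top"
    by (simp add: zero_prod_def)
  moreover have "continuous_on C (\<lambda>(x, y). (P x y, y))"
    using contP unfolding case_prod_beta by (intro continuous_intros)
  \<comment> \<open>Force and momentum are made to vanish jointly: at \<open>y = 0\<close> the
    damping term drops out of \<open>P x y\<close>, leaving
    \<open>transpose B *v G x = 0\<close>.\<close>
  ultimately have "converges_to_set (\<lambda>t. (z t, p t)) {w \<in> C. (\<lambda>(x, y). (P x y, y)) w = 0}"
    by (intro converges_to_zero_set_on_compact[OF C _ ev])
  moreover have "{w \<in> C. (\<lambda>(x, y). (P x y, y)) w = 0}
      \<subseteq> {(x, y). x \<in> K \<and> transpose B *v G x = 0 \<and> y = 0}"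
    by (auto simp: C_def P_def zero_prod_def)
  ultimately show ?thesis
    unfolding converges_to_set_def by (elim all_forward imp_forward eventually_mono) blast+
qed

section \<open>Block structure and the domain of the relative positions\<close>

lemma linear_block: "linear (\<lambda>x. block x a)"
  by (rule linearI) (simp_all add: block_def vec_eq_iff)

lemma bounded_linear_block: "bounded_linear (\<lambda>x. block x a)"
  using linear_block linear_conv_bounded_linear by blast

lemma sum_inner_block: "(\<Sum>a\<in>UNIV. block x a \<bullet> block y a) = x \<bullet> y"
  by (simp add: inner_vec_def block_def sum.cartesian_product flip: UNIV_Times_UNIV)

lemma norm_block_le: "norm (block x a) \<le> norm x"
proof -
  have "block x a \<bullet> block x a \<le> (\<Sum>a\<in>UNIV. block x a \<bullet> block x a)"
    by (rule member_le_sum) auto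
  then show ?thesis by (simp add: sum_inner_block norm_eq_sqrt_inner)
qed

lemma block_block_diag_mult: "block (block_diag D *v x) a = D a *v block x a"
proof -
  have "(\<Sum>t\<in>UNIV. (if a = fst t then D (fst t) $ l $ snd t else 0) * x $ t)
      = (\<Sum>m\<in>UNIV. D a $ l $ m * x $ (a, m))" for l
  proof -
    have "(\<Sum>t\<in>UNIV. (if a = fst t then D (fst t) $ l $ snd t else 0) * x $ t)
       = (\<Sum>b\<in>UNIV. \<Sum>m\<in>UNIV. if a = b then D b $ l $ m * x $ (b, m) else 0)"
      unfolding sum.cartesian_product UNIV_Times_UNIV by (rule sum.cong) auto
    also have "\<dots> = (\<Sum>b\<in>UNIV. if a = b then \<Sum>m\<in>UNIV. D b $ l $ m * x $ (b, m) else 0)"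
      by (rule sum.cong) auto
    finally show ?thesis by simp
  qed
  then show ?thesis
    by (simp add: vec_eq_iff block_def block_diag_def matrix_vector_mult_def cong: if_cong)
qed

text \<open>The quadratic form is the sum of the forms of the blocks; all are nonnegative, and a
  nonzero block of \<open>x\<close> makes one positive.\<close>

lemma block_diag_pos_def:
  assumes D: "\<And>j. sym_pos_def (D j)" and x: "x \<noteq> 0"
  shows "0 < x \<bullet> (block_diag D *v x)"
proof -
  obtain j where j: "block x j \<noteq> 0"
    using x by (auto simp: vec_eq_iff block_def)
  have "0 < (\<Sum>j\<in>UNIV. block x j \<bullet> (D j *v block x j))"
  proof (rule sum_pos2[of _ j])
    show "0 \<le> block x i \<bullet> (D i *v block x i)" for i
      using D[of i] by (cases "block x i = 0") (auto simp: sym_pos_def_def intro: less_imp_le)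
  qed (use D[of j] j in \<open>auto simp: sym_pos_def_def\<close>)
  then show ?thesis by (simp add: sum_inner_block flip: block_block_diag_mult)
qed

text \<open>As an intersection of preimages of a ball under linear maps, the domain inherits
  convexity and closedness.\<close>

lemma zdom_eq: "zdom r = (\<Inter>j. (\<lambda>z. block z j) -` cball 0 r)"
  by (auto simp: zdom_def)

lemma convex_zdom: "convex (zdom r)"
  unfolding zdom_eq by (intro convex_INT convex_linear_vimage linear_block) auto

lemma interior_zdom: "0 < r \<Longrightarrow> interior (zdom r) \<noteq> {}"
proof -
  assume r: "0 < r"
  have "ball 0 r \<subseteq> zdom r" by (auto simp: zdom_def intro: order_trans[OF norm_block_le] less_imp_le)
  then have "ball 0 r \<subseteq> interior (zdom r)" by (rule interior_maximal) simp
  then show ?thesis using r by (metis centre_in_ball empty_iff subsetD)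
qed

lemma compact_zdom: "compact (zdom r :: (real ^ ('e::finite \<times> 'n::finite)) set)"
proof -
  have "closed (zdom r :: (real ^ ('e \<times> 'n)) set)"
    unfolding zdom_eq
    by (intro closed_INT ballI closed_vimage closed_cball linear_continuous_on bounded_linear_block)
  moreover have "bounded (zdom r :: (real ^ ('e \<times> 'n)) set)"
  proof (rule boundedI)
    fix z :: "real ^ ('e \<times> 'n)" assume "z \<in> zdom r"
    then have "z \<bullet> z \<le> (\<Sum>j\<in>(UNIV :: 'e set). r * r)"
      unfolding sum_inner_block[symmetric]
      by (intro sum_mono) (auto simp: zdom_def dot_square_norm power2_eq_square intro!: mult_mono')
    then show "norm z \<le> sqrt (\<Sum>j\<in>(UNIV :: 'e set). r * r)"
      by (simp add: norm_eq_sqrt_inner)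
  qed
  ultimately show ?thesis by (simp add: compact_eq_bounded_closed)
qed

section \<open>Gradients of the Hamiltonian and the closed loop\<close>

text \<open>The gradient of \<open>k y * (norm y - \<rho>)\<^sup>2\<close>, twice the energy of a
  spring, with \<open>g\<close> the gradient of \<open>k\<close>. As \<open>sgn 0 = 0\<close>, the
  formula is also correct at the origin when \<open>\<rho> = 0\<close>.\<close>

definition spring_gradient ::
    "('v::real_inner \<Rightarrow> real) \<Rightarrow> ('v \<Rightarrow> 'v) \<Rightarrow> real \<Rightarrow> 'v \<Rightarrow> 'v" where
  "spring_gradient k g \<rho> y = (norm y - \<rho>)\<^sup>2 *\<^sub>R g y + (2 * k y) *\<^sub>R (y - \<rho> *\<^sub>R sgn y)"

text \<open>In the expansion \<open>y \<bullet> y - 2 * \<rho> * norm y + \<rho>\<^sup>2\<close> of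
  the square, the norm occurs only with the factor \<open>\<rho>\<close>. Hence its kink at the
  origin matters only for a positive rest length.\<close>

lemma has_gradient_within_spring:
  assumes k: "has_gradient_within k (g y) y S" and y: "\<rho> = 0 \<or> y \<noteq> 0"
  shows "has_gradient_within (\<lambda>y. k y * (norm y - \<rho>)\<^sup>2) (spring_gradient k g \<rho> y) y S"
proof -
  have "((\<lambda>y. \<rho> * norm y) has_derivative (\<lambda>h. \<rho> * (sgn y \<bullet> h))) (at y within S)"
  proof (cases "\<rho> = 0")
    case False
    then have "(norm has_derivative (\<lambda>h. sgn y \<bullet> h)) (at y within S)"
      using has_derivative_at_withinI[OF has_derivative_norm[of y]] y by (simp add: inner_commute)
    then show ?thesis by (rule has_derivative_mult_right)
  qed simp
  from has_derivative_add[OF has_derivative_diff[OF has_derivative_inner[OF has_derivative_ident has_derivative_ident]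
        has_derivative_scaleR_right[OF this, of 2]] has_derivative_const[of "\<rho>\<^sup>2"]]
  have sq: "((\<lambda>y. (norm y - \<rho>)\<^sup>2) has_derivative (\<lambda>h. 2 * ((y - \<rho> *\<^sub>R sgn y) \<bullet> h))) (at y within S)"
    by (simp add: power2_eq_square algebra_simps inner_commute flip: power2_norm_eq_inner)
  show ?thesis
    using has_derivative_mult[OF k[unfolded has_gradient_within_def] sq]
    by (simp add: has_gradient_within_def spring_gradient_def inner_add_left inner_diff_left algebra_simps)
qed

lemma continuous_on_spring_gradient:
  assumes k: "continuous_on S k" and g: "continuous_on S g" and S: "\<And>y. y \<in> S \<Longrightarrow> \<rho> = 0 \<or> y \<noteq> 0"
  shows "continuous_on S (spring_gradient k g \<rho>)"
proof -
  have "continuous_on S (\<lambda>y. \<rho> *\<^sub>R sgn y)"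
  proof (cases "\<rho> = 0")
    case False
    then show ?thesis using S by (intro continuous_intros) auto
  qed simp
  then have *: "continuous_on S (\<lambda>y. y - \<rho> *\<^sub>R sgn y)"
    by (intro continuous_on_diff continuous_on_id)
  show ?thesis
    unfolding spring_gradient_def
    by (rule continuous_on_add[OF _ continuous_on_scaleR[OF _ *]])
      (intro continuous_intros k g)+
qed

lemma dHdp_eq: "dHdp k rest z p = p"
proof -
  have "has_gradient_within (\<lambda>\<eta>. hamiltonian k rest z \<eta>) p p UNIV"
    unfolding has_gradient_within_def hamiltonian_def sum_inner_block
    by (auto intro!: derivative_eq_intros simp: inner_commute)
  then show ?thesis
    unfolding dHdp_def by (intro gradient_within_eqI) auto
qed

lemma has_gradient_within_hamiltonian:
  assumes "\<And>j. has_gradient_within (\<lambda>y. k j y * (norm y - rest j)\<^sup>2) (\<gamma> j) (block z j) (cball 0 r)"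
  shows "has_gradient_within (\<lambda>\<zeta>. hamiltonian k rest \<zeta> p) (\<chi> s. \<gamma> (fst s) $ snd s / 2) z (zdom r)"
proof -
  have "((\<lambda>\<zeta>. k j (block \<zeta> j) * (norm (block \<zeta> j) - rest j)\<^sup>2) has_derivative (\<lambda>h. \<gamma> j \<bullet> block h j))
      (at z within zdom r)" for j
  proof (rule has_derivative_in_compose[where g = "\<lambda>y. k j y * (norm y - rest j)\<^sup>2"])
    show "((\<lambda>\<zeta>. block \<zeta> j) has_derivative (\<lambda>h. block h j)) (at z within zdom r)"
      by (rule bounded_linear_imp_has_derivative[OF bounded_linear_block])
    show "((\<lambda>y. k j y * (norm y - rest j)\<^sup>2) has_derivative (\<bullet>) (\<gamma> j))
        (at (block z j) within (\<lambda>\<zeta>. block \<zeta> j) ` zdom r)"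
      by (rule has_derivative_subset[OF assms[unfolded has_gradient_within_def]])
        (auto simp: zdom_def)
  qed
  then have "((\<lambda>\<zeta>. hamiltonian k rest \<zeta> p) has_derivative
      (\<lambda>h. 0 + 1 / 2 * (\<Sum>j\<in>UNIV. \<gamma> j \<bullet> block h j))) (at z within zdom r)"
    unfolding hamiltonian_def
    by (intro has_derivative_add has_derivative_const has_derivative_mult_right has_derivative_sum)
  \<comment> \<open>The leading 0 is the derivative of the kinetic term, which is constant in the
    relative positions.\<close>
  moreover have "0 + 1 / 2 * (\<Sum>j\<in>UNIV. \<gamma> j \<bullet> block h j) = (\<chi> s. \<gamma> (fst s) $ snd s / 2) \<bullet> h"
    for h :: "real ^ ('a \<times> 'b)"
  proof -
    have "block (\<chi> s. \<gamma> (fst s) $ snd s / 2) j = (1 / 2) *\<^sub>R \<gamma> j" for j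
      by (simp add: block_def vec_eq_iff)
    then show ?thesis
      by (simp add: sum_divide_distrib flip: sum_inner_block)
  qed
  ultimately show ?thesis by (simp add: has_gradient_within_def)
qed

text \<open>\<open>no_drift\<close> says that \<open>p 0\<close> is orthogonal to the kernel of
  \<open>Bbar tail head\<close>, so each connected component has zero total momentum. This quantity
  is conserved, and a nonzero value would keep \<open>p\<close> from tending to 0.
  \<open>no_collision\<close> keeps limit points of \<open>z\<close> away from configurations with
  \<open>z_j = 0\<close> and positive rest length, where the gradient breaks down.\<close>

theorem proposition1:
  fixes tail head :: "'e::finite \<Rightarrow> 'i::finite"
    and D :: "'e \<Rightarrow> real ^ 'n::finite ^ 'n"
    and k :: "'e \<Rightarrow> real ^ 'n \<Rightarrow> real"
    and rest :: "'e \<Rightarrow> real"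
    and rc r :: real
    and z :: "real \<Rightarrow> real ^ ('e \<times> 'n)"
    and p :: "real \<Rightarrow> real ^ ('i \<times> 'n)"
  assumes edges: "\<And>j. tail j \<noteq> head j"
    and damping: "\<And>j. sym_pos_def (D j)"
    and rc_pos: "0 < rc"
    and rest_length: "\<And>j. 0 \<le> rest j \<and> rest j \<le> rc"
    and r_pos: "0 < r"
    and k_pos: "\<And>j x. x \<in> cball 0 r \<Longrightarrow> 0 < k j x"
    and k_C1: "\<And>j. C1_on (cball 0 r) (k j)"
    and k_even: "\<And>j x. x \<in> cball 0 r \<Longrightarrow> k j (- x) = k j x"
    and solution: "closed_loop_solution tail head D r k rest z p"
    and no_drift: "p 0 \<in> range ((*v) (transpose (Bbar tail head)))"
    and no_collision: "\<exists>\<delta>>0. \<forall>t\<ge>0. \<forall>j. 0 < rest j \<longrightarrow> \<delta> \<le> norm (block (z t) j)"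
  shows "converges_to_set (\<lambda>t. (z t, p t)) (Sset tail head r k rest)"
proof -
  obtain \<delta> where \<delta>: "0 < \<delta>" "\<And>t j. 0 \<le> t \<Longrightarrow> 0 < rest j \<Longrightarrow> \<delta> \<le> norm (block (z t) j)"
    using no_collision by blast
  obtain g where g: "\<And>j. continuous_on (cball 0 r) (g j)"
    and kg: "\<And>j x. x \<in> cball 0 r \<Longrightarrow> has_gradient_within (k j) (g j x) x (cball 0 r)"
    using k_C1 unfolding C1_on_def by metis
  have k: "continuous_on (cball 0 r) (k j)" for j
    using kg unfolding continuous_on_eq_continuous_within has_gradient_within_def
    by (meson has_derivative_continuous)
  \<comment> \<open>The margin \<open>\<delta>\<close>, in place of the open condition that the
    block is nonzero, makes this set closed and hence compact.\<close>
  define K :: "(real ^ ('e \<times> 'n)) set"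
    where "K = zdom r \<inter> {z. \<forall>j. 0 < rest j \<longrightarrow> \<delta> \<le> norm (block z j)}"
  have K: "compact K" "K \<subseteq> zdom r"
    unfolding K_def
    by (auto intro!: compact_Int_closed compact_zdom closed_Collect_all closed_Collect_imp
        closed_Collect_le continuous_on_norm continuous_on_const linear_continuous_on[OF bounded_linear_block])
  define G :: "real ^ ('e \<times> 'n) \<Rightarrow> real ^ ('e \<times> 'n)"
    where "G z = (\<chi> s. spring_gradient (k (fst s)) (g (fst s)) (rest (fst s)) (block z (fst s)) $ snd s / 2)"
    for z
  have away: "block z j \<in> {y \<in> cball 0 r. rest j = 0 \<or> y \<noteq> 0}" if "z \<in> K" for z j
  proof -
    have "norm (block z j) \<le> r" "0 < rest j \<Longrightarrow> \<delta> \<le> norm (block z j)"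
      using that by (auto simp: K_def zdom_def)
    then show ?thesis using \<delta>(1) rest_length[of j] by (cases "rest j = 0") auto
  qed
  have G: "continuous_on K G"
  proof -
    have "continuous_on K (\<lambda>z. spring_gradient (k j) (g j) (rest j) (block z j))" for j
    proof (rule continuous_on_compose2[where f = "\<lambda>z. block z j"])
      show "continuous_on {y \<in> cball 0 r. rest j = 0 \<or> y \<noteq> 0} (spring_gradient (k j) (g j) (rest j))"
        by (rule continuous_on_spring_gradient)
          (auto intro: continuous_on_subset[OF k] continuous_on_subset[OF g])
    qed (use away in \<open>auto intro: linear_continuous_on bounded_linear_block\<close>)
    then show ?thesis
      unfolding G_def by (intro continuous_on_vec_lambda continuous_intros) auto
  qed
  have grad: "has_gradient_within (\<lambda>\<zeta>. hamiltonian k rest \<zeta> y) (G x) x (zdom r)"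
    if "x \<in> K" for x and y :: "real ^ ('i \<times> 'n)"
    unfolding G_def
    by (rule has_gradient_within_hamiltonian, rule has_gradient_within_spring)
      (use kg away[OF that] in auto)
  \<comment> \<open>The value is the same for every momentum, so the gradient in the dynamics agrees
    with the one at momentum 0 in \<open>Zset\<close>.\<close>
  have dHdz: "dHdz r k rest x y = G x" if "x \<in> K" for x and y :: "real ^ ('i \<times> 'n)"
    unfolding dHdz_def using that K(2)
    by (intro gradient_within_eqI convex_zdom interior_zdom r_pos grad) auto
  have zK: "z t \<in> K" if "0 \<le> t" for t
    using solution \<delta>(2) that by (auto simp: closed_loop_solution_def Let_def H_z_diff_def K_def)
  \<comment> \<open>At momentum 0 the Hamiltonian is the potential energy alone, which serves as
    \<open>V\<close>.\<close>
  have "converges_to_set (\<lambda>t. (z t, p t))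
      {(x, y). x \<in> K \<and> transpose (Bbar tail head) *v G x = 0 \<and> y = 0}"
    by (rule damped_interconnection_converges
        [where V = "\<lambda>\<zeta>. hamiltonian k rest \<zeta> (0 :: real ^ ('i \<times> 'n))" and R = "block_diag D"])
      (use K grad G block_diag_pos_def[OF damping] zK no_drift solution
        in \<open>auto simp: closed_loop_solution_def Let_def dHdp_eq dHdz\<close>)
  moreover have "{(x, y). x \<in> K \<and> transpose (Bbar tail head) *v G x = 0 \<and> y = 0}
      \<subseteq> Sset tail head r k rest"
    using K(2) grad by (auto simp: Sset_def Zset_def H_z_diff_def dHdz)
  ultimately show ?thesis
    unfolding converges_to_set_def by (elim all_forward imp_forward eventually_mono) blast+
qed

end
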